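(* Let $w\in S_n$ and $D\in\mathrm{RPD}(w)$ such that $(i,j)$ is a movable cross tile in $D$. Let $h=h_{ij}(D)$ and $k=k_{ij}(D)$. Then $\mathcal{M}_{ij}(D)$ is equal to the output of the following procedure applied to $D$: (i) For each $r\in[h,i]$, if there is a bump tile (of $D$) in row $r$ of $\mathrm{Path}_{ij}(D)$, replace $(r,j)$ with a bump tile. (ii) For each $c\in[j,k]$, if there is a bump tile (of $D$) in column $c$ of $\mathrm{Path}_{ij}(D)$, replace $(i,c)$ with a bump tile. (iii) Replace each bump tile in $\mathrm{Path}_{ij}(D)$ with a cross tile, except for the endpoints $(h,j)$ and $(i,k)$.
   Context: A pipe dream is a finite subset $D\subset \mathbb{Z}_{>0}\times\mathbb{Z}_{>0}$, in matrix coordinates ($(i,j)$ is row $i$ from the top, column $j$ from the left). Place a cross tile at each $(i,j)\in D$ (one strand joins the left and right edges, the other joins the top and bottom edges) and a bump tile at each $(i,j)\notin D$ (one strand joins the top edge to the left edge, the other joins the right edge to the bottom edge). Write $D(i,j)=+$ if $(i,j)\in D$ and $D(i,j)=\bullet$ otherwise. The strands form pipes going from the top boundary to the left boundary; pipe $x$ is the one entering at the top of column $x$. The permutation $w$ of $D$ is defined by: $w(i)$ is the label of the pipe that exits the left boundary in row $i$. Permutations $w\in S_n$ are regarded as permutations of $\mathbb{Z}_{>0}$ fixing all $m>n$. $\mathrm{RPD}(w)$ is the set of reduced pipe dreams for $w$: pipe dreams $D$ whose permutation is $w$ and such that $|D|$ equals the number of inversions of $w$. Generalized ladder move: let $D\in\mathrm{RPD}(w)$,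 and suppose there are $h<i$ and $j<k$ such that $D(i,j)=+$, $D(h,j)=D(i,k)=D(h,k)=\bullet$, and every other tile in $[h,i]\times[j,k]$ is a $+$. Then $(i,j)$ is called ladder movable in $D$, and $\mathcal{L}_{ij}(D)\in\mathrm{RPD}(w)$ is obtained from $D$ by swapping the tiles at $(i,j)$ and $(h,k)$ (given $(i,j)$, the pair $(h,k)$ is unique). Move operators: a cross tile $(i,j)$ of $D$ is movable in $D$ if $D(h,j)=\bullet$ for some $h\in[1,i-1]$. Then put $h_{ij}(D)=\max\{h\in[1,i-1]: D(h,j)=\bullet\}$, $k_{ij}(D)=\min\{k\in[j+1,n]: D(i,k)=\bullet\}$ (which exists), $\mathrm{Rect}_{ij}(D)=[h,i]\times[j,k]$ with $h=h_{ij}(D)$, $k=k_{ij}(D)$, let $a=\mathrm{maxrow}_{ij}(D)$ be the largest $p\in[h,i)$ such that row $p$ contains a $\bullet$ in $\mathrm{Rect}_{ij}(D)$, and let $b$ be the smallest $q\in(j,k]$ such that column $q$ contains a $\bullet$ in $\mathrm{Rect}_{ij}(D)$. Define $\mathcal{M}_{ij}(D)$ recursively for $(i,j)$ movable in $D$: (i) if $a=h$ and $b=k$, then $(i,j)$ is ladder movable and $\mathcal{M}_{ij}(D)=\mathcal{L}_{ij}(D)$; (ii) if $a>h$, $\mathcal{M}_{ij}(D)=\mathcal{M}_{ij}(\mathcal{M}_{aj}(D))$; (iii) otherwise, $\mathcal{M}_{ij}(D)=\mathcal{M}_{ij}(\mathcal{M}_{ib}(D))$. This recursion is well defined and terminates.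 Path: for $(i,j)$ movable in $D$, $\mathrm{Path}_{ij}(D)$ is the lattice path (set of positions) built as follows. Start with $(p,q)=(i,k_{ij}(D))$ and the set $\{(p,q)\}$. Step A: let $p'=\mathrm{maxrow}_{pj}(D)$ and add $(p',q),(p'+1,q),\dots,(p-1,q)$. Step B: let $q'=\min\{t\ge j: D(p',t)=\bullet\}$ and add $(p',q'),(p',q'+1),\dots,(p',q-1)$. If $q'=j$, stop; otherwise set $(p,q)=(p',q')$ and return to Step A. The endpoints of the path are $(i,k_{ij}(D))$ and $(h_{ij}(D),j)$. *)

theory Defs
  imports "HOL-Combinatorics.Permutations"
begin

text \<open>
  A tiling is the set of the positions (row, column) of its cross tiles; a position outside the
  set carries a bump tile. Rows and columns are counted from 1.
\<close>

type_synonym tiling = "(nat \<times> nat) set"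

definition pipe_dream :: "tiling \<Rightarrow> bool" where
  "pipe_dream D \<longleftrightarrow> finite D \<and> D \<subseteq> {1..} \<times> {1..}"

datatype edge = TopEdge | RightEdge

text \<open>
  \<open>exits D e r c s\<close>: a pipe entering the tile \<open>(r, c)\<close> through its edge \<open>e\<close> eventually exits the
  left boundary in row \<open>s\<close>. A pipe that leaves column 1 to the left "enters column 0".
\<close>

inductive exits :: "tiling \<Rightarrow> edge \<Rightarrow> nat \<Rightarrow> nat \<Rightarrow> nat \<Rightarrow> bool" for D where
  boundary: "exits D RightEdge r 0 r"
| cross_top: "c \<ge> 1 \<Longrightarrow> (r, c) \<in> D \<Longrightarrow> exits D TopEdge (r + 1) c s \<Longrightarrow> exits D TopEdge r c s"
| cross_right: "c \<ge> 1 \<Longrightarrow> (r, c) \<in> D \<Longrightarrow> exits D RightEdge r (c - 1) s \<Longrightarrow> exits D RightEdge r c s"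
| bump_top: "c \<ge> 1 \<Longrightarrow> (r, c) \<notin> D \<Longrightarrow> exits D RightEdge r (c - 1) s \<Longrightarrow> exits D TopEdge r c s"
| bump_right: "c \<ge> 1 \<Longrightarrow> (r, c) \<notin> D \<Longrightarrow> exits D TopEdge (r + 1) c s \<Longrightarrow> exits D RightEdge r c s"

definition has_perm :: "tiling \<Rightarrow> (nat \<Rightarrow> nat) \<Rightarrow> bool" where
  "has_perm D w \<longleftrightarrow> (\<forall>r\<ge>1. w r \<ge> 1 \<and> exits D TopEdge 1 (w r) r)"

definition inversions :: "(nat \<Rightarrow> nat) \<Rightarrow> (nat \<times> nat) set" where
  "inversions w = {(a, b). 1 \<le> a \<and> a < b \<and> w b < w a}"

definition RPD :: "(nat \<Rightarrow> nat) \<Rightarrow> tiling set" where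
  "RPD w = {D. pipe_dream D \<and> has_perm D w \<and> card D = card (inversions w)}"

definition ladder_rect :: "tiling \<Rightarrow> nat \<Rightarrow> nat \<Rightarrow> nat \<Rightarrow> nat \<Rightarrow> bool" where
  "ladder_rect D i j h k \<longleftrightarrow> 1 \<le> h \<and> h < i \<and> 1 \<le> j \<and> j < k \<and>
     (i, j) \<in> D \<and> (h, j) \<notin> D \<and> (i, k) \<notin> D \<and> (h, k) \<notin> D \<and>
     {h..i} \<times> {j..k} - {(i, j), (h, j), (i, k), (h, k)} \<subseteq> D"

text \<open>At most one pair \<open>(h, k)\<close> satisfies \<^const>\<open>ladder_rect\<close> for given \<open>D\<close>, \<open>i\<close>, \<open>j\<close>.\<close>

definition ladder_move :: "nat \<Rightarrow> nat \<Rightarrow> tiling \<Rightarrow> tiling" where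
  "ladder_move i j D = insert (THE (h, k). ladder_rect D i j h k) (D - {(i, j)})"

definition movable :: "tiling \<Rightarrow> nat \<Rightarrow> nat \<Rightarrow> bool" where
  "movable D i j \<longleftrightarrow> (i, j) \<in> D \<and> (\<exists>h\<in>{1..i - 1}. (h, j) \<notin> D)"

definition hrow :: "tiling \<Rightarrow> nat \<Rightarrow> nat \<Rightarrow> nat" where
  "hrow D i j = Max {h \<in> {1..i - 1}. (h, j) \<notin> D}"

definition kcol :: "nat \<Rightarrow> tiling \<Rightarrow> nat \<Rightarrow> nat \<Rightarrow> nat" where
  "kcol n D i j = Min {k \<in> {j + 1..n}. (i, k) \<notin> D}"

definition rect :: "nat \<Rightarrow> tiling \<Rightarrow> nat \<Rightarrow> nat \<Rightarrow> (nat \<times> nat) set" where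
  "rect n D i j = {hrow D i j..i} \<times> {j..kcol n D i j}"

definition maxrow :: "nat \<Rightarrow> tiling \<Rightarrow> nat \<Rightarrow> nat \<Rightarrow> nat" where
  "maxrow n D i j = Max {p \<in> {hrow D i j..<i}. \<exists>q. (p, q) \<in> rect n D i j - D}"

definition mincol :: "nat \<Rightarrow> tiling \<Rightarrow> nat \<Rightarrow> nat \<Rightarrow> nat" where
  "mincol n D i j = Min {q \<in> {j<..kcol n D i j}. \<exists>p. (p, q) \<in> rect n D i j - D}"

text \<open>
  The move operator is only meaningful at movable cross tiles. Its termination (for reduced pipe
  dreams of permutations in \<open>S\<^sub>n\<close>) is not established here; the function is specified on the
  domain \<open>move_dom\<close> of the recursion.
\<close>

function (domintros) move :: "nat \<Rightarrow> nat \<Rightarrow> nat \<Rightarrow> tiling \<Rightarrow> tiling" where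
  "move n i j D =
    (if \<not> movable D i j then undefined
     else if maxrow n D i j = hrow D i j \<and> mincol n D i j = kcol n D i j then ladder_move i j D
     else if maxrow n D i j > hrow D i j then move n i j (move n (maxrow n D i j) j D)
     else move n i j (move n i (mincol n D i j) D))"
  by pat_completeness auto

definition first_bump :: "tiling \<Rightarrow> nat \<Rightarrow> nat \<Rightarrow> nat" where
  "first_bump D p j = (LEAST t. j \<le> t \<and> (p, t) \<notin> D)"

text \<open>
  The lattice path is built by a loop; \<open>path_state\<close> collects the values of \<open>(p, q)\<close> with which
  the loop body is entered, and each of them contributes a vertical and a horizontal segment.
\<close>

inductive_set path_state :: "nat \<Rightarrow> tiling \<Rightarrow> nat \<Rightarrow> nat \<Rightarrow> (nat \<times> nat) set" for n D i j where
  start: "(i, kcol n D i j) \<in> path_state n D i j"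
| again: "(p, q) \<in> path_state n D i j \<Longrightarrow> p' = maxrow n D p j \<Longrightarrow> q' = first_bump D p' j \<Longrightarrow>
    q' \<noteq> j \<Longrightarrow> (p', q') \<in> path_state n D i j"

definition step_A :: "nat \<Rightarrow> tiling \<Rightarrow> nat \<Rightarrow> nat \<Rightarrow> nat \<Rightarrow> (nat \<times> nat) set" where
  "step_A n D j p q = {maxrow n D p j..<p} \<times> {q}"

definition step_B :: "nat \<Rightarrow> tiling \<Rightarrow> nat \<Rightarrow> nat \<Rightarrow> nat \<Rightarrow> (nat \<times> nat) set" where
  "step_B n D j p q = {maxrow n D p j} \<times> {first_bump D (maxrow n D p j) j..<q}"

definition path :: "nat \<Rightarrow> tiling \<Rightarrow> nat \<Rightarrow> nat \<Rightarrow> (nat \<times> nat) set" where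
  "path n D i j = {(i, kcol n D i j)} \<union>
     (\<Union>(p, q)\<in>path_state n D i j. step_A n D j p q \<union> step_B n D j p q)"

definition path_procedure :: "nat \<Rightarrow> nat \<Rightarrow> nat \<Rightarrow> tiling \<Rightarrow> tiling" where
  "path_procedure n i j D =
    (let h = hrow D i j; k = kcol n D i j; P = path n D i j;
         D1 = D - {(r, j) |r. r \<in> {h..i} \<and> (\<exists>c. (r, c) \<in> P - D)};
         D2 = D1 - {(i, c) |c. c \<in> {j..k} \<and> (\<exists>r. (r, c) \<in> P - D)}
     in D2 \<union> ((P - D2) - {(h, j), (i, k)}))"

end

theory Submission
  imports Defs
begin

text \<open>
  Reducedness enters only twice. Pairs of pipes that form an inversion must cross, so by counting
  the crosses correspond bijectively to the inversions of \<open>w\<close>. Hence no pair crosses twice, and no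
  cross of a pipe dream of \<open>w \<in> S\<^sub>n\<close> lies in a position \<open>(r, c)\<close> with \<open>r + c > n\<close>; the latter makes
  \<open>kcol\<close> meaningful.

  If only the rows \<open>h\<close> and \<open>i\<close> of the rectangle contain bumps, then the move is a chain of
  ladder moves that shifts the bumps of row \<open>h\<close>, from right to left, down to row \<open>i\<close>. Otherwise let
  \<open>a\<close> be the lowest row with a bump above \<open>i\<close>. By induction the move at \<open>(a, j)\<close> collects in row \<open>a\<close>
  one bump for each column with a bump on the upper part of the path, and a chain of ladder moves
  then shifts these to row \<open>i\<close>. The intermediate tilings need not be shown to be reduced: that \<open>(a, k)\<close>
  is a bump follows from the absence of double crossings in \<open>D\<close> itself.
\<close>

section \<open>Strands of a reduced pipe dream\<close>

lemma exits_unique: "exits D e r c s \<Longrightarrow> exits D e r c t \<Longrightarrow> s = t"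
proof (induction arbitrary: t rule: exits.induct)
  case (boundary r) then show ?case by (auto elim: exits.cases)
next
  case (cross_top c r s)
  from cross_top.prems show ?case by cases (use cross_top.hyps in \<open>auto intro: cross_top.IH\<close>)
next
  case (cross_right c r s)
  from cross_right.prems show ?case by cases (use cross_right.hyps in \<open>auto intro: cross_right.IH\<close>)
next
  case (bump_top c r s)
  from bump_top.prems show ?case by cases (use bump_top.hyps in \<open>auto intro: bump_top.IH\<close>)
next
  case (bump_right c r s)
  from bump_right.prems show ?case by cases (use bump_right.hyps in \<open>auto intro: bump_right.IH\<close>)
qed

lemma exits_row_le: "exits D e r c s \<Longrightarrow> r \<le> s"
  by (induction rule: exits.induct) auto

text \<open>The outer induction is on the column. Within a column a pipe keeps falling only through
  crosses, which end above row \<open>R\<close>; a bump met from above sends it one column to the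
  left.\<close>

lemma exits_total:
  assumes "finite D"
  shows "\<exists>s. exits D RightEdge r c s" and "c \<ge> 1 \<Longrightarrow> \<exists>s. exits D TopEdge r c s"
proof -
  obtain R where R: "\<And>r c. (r, c) \<in> D \<Longrightarrow> r < R"
    using finite_nat_set_iff_bounded[of "fst ` D"] assms by force
  have *: "(\<forall>r. \<exists>s. exits D RightEdge r c s) \<and> (c \<ge> 1 \<longrightarrow> (\<forall>r. \<exists>s. exits D TopEdge r c s))" for c
  proof (induction c)
    case 0 then show ?case by (auto intro: exits.boundary)
  next
    case (Suc c)
    have top: "\<exists>s. exits D TopEdge r (Suc c) s" for r
    proof (induction "R - r" arbitrary: r rule: less_induct)
      case less
      show ?case
      proof (cases "(r, Suc c) \<in> D")
        case True
        then have "R - (r + 1) < R - r" using R by fastforce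
        then obtain s where "exits D TopEdge (r + 1) (Suc c) s" using less by blast
        then show ?thesis using True exits.cross_top[of "Suc c"] by force
      next
        case False
        then show ?thesis using Suc exits.bump_top[of "Suc c" r D] by force
      qed
    qed
    have "\<exists>s. exits D RightEdge r (Suc c) s" for r
      using Suc top[of "r + 1"] exits.bump_right[of "Suc c" r D] exits.cross_right[of "Suc c" r D]
      by (cases "(r, Suc c) \<in> D") force+
    with top show ?case by auto
  qed
  show "\<exists>s. exits D RightEdge r c s" and "c \<ge> 1 \<Longrightarrow> \<exists>s. exits D TopEdge r c s"
    using * by blast+
qed

text \<open>Pipes are named by their exit rows. For a cross this gives an unordered pair comparable
  with an inversion \<open>(a, b)\<close> of \<open>w\<close>, whose entries are arguments of
  \<open>w\<close> and hence exit rows too.\<close>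

definition strands :: "tiling \<Rightarrow> nat \<times> nat \<Rightarrow> nat set" where
  "strands D x = {s. \<exists>e. exits D e (fst x) (snd x) s}"

lemma strands_eq:
  assumes "exits D TopEdge r c s" "exits D RightEdge r c t"
  shows "strands D (r, c) = {s, t}"
proof -
  have "u = s \<or> u = t" if "exits D e r c u" for e u
    using assms exits_unique that by (cases e) blast+
  then show ?thesis using assms by (auto simp: strands_def)
qed

fun edge_pos :: "edge \<Rightarrow> nat \<Rightarrow> nat" where
  "edge_pos TopEdge c = 2 * c"
| "edge_pos RightEdge c = 2 * c + 1"

text \<open>
  Every tile a pipe traverses increases \<open>r - c\<close> by one, so two pipes can be compared at equal
  values of \<open>r - c\<close>; along such a diagonal \<^const>\<open>edge_pos\<close> is the position of the entered edge,
  and the order of two pipes changes only in a cross tile that they share.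
\<close>

lemma exits_order:
  assumes "exits D e r c a" "exits D e' r' c' b" "r + c' = r' + c" "edge_pos e c < edge_pos e' c'"
  shows "a < b \<or> (\<exists>x\<in>D. strands D x = {a, b})"
  using assms
proof (induction arbitrary: e' r' c' rule: exits.induct)
  case (boundary r)
  from boundary.prems(3) have "c' \<ge> 1" by (cases e') auto
  with boundary.prems exits_row_le[OF boundary.prems(1)] show ?case by auto
next
  case (cross_top c r s)
  show ?case
  proof (cases "c' = c")
    case True
    then have "e' = RightEdge" "r' = r" using cross_top.prems by (cases e'; auto)+
    then have "strands D (r, c) = {s, b}"
      using strands_eq[OF exits.cross_top[OF cross_top.hyps]] cross_top.prems(1) True by auto
    then show ?thesis using cross_top.hyps by blast
  next
    case False
    \<comment> \<open>One tile takes \<open>edge_pos\<close> in column \<open>c\<close> to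
      \<open>2 * c\<close> or \<open>2 * c - 1\<close>, so pipes in different columns of a diagonal
      cannot change places.\<close>
    then have "c' > c" using cross_top.prems by (cases e') auto
    from cross_top.prems(1) show ?thesis
      using \<open>c' > c\<close> cross_top.prems(2,3) cross_top.hyps(1,2)
      by cases ((simp; fail) | (rule cross_top.IH, assumption, (simp; fail), (simp; fail)))+
  qed
next
  case (bump_top c r s)
  show ?case
  proof (cases "c' = c")
    case True
    \<comment> \<open>In a shared bump the pipe from the top goes on to position
      \<open>2 * c - 1\<close> and the one from the right to \<open>2 * c\<close>, which keeps their
      order.\<close>
    then have "e' = RightEdge" "r' = r" using bump_top.prems by (cases e'; auto)+
    with True bump_top.hyps have "exits D TopEdge (r + 1) c b"
      using bump_top.prems(1) by (auto elim: exits.cases)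
    then show ?thesis by (rule bump_top.IH) (use bump_top.hyps in auto)
  next
    case False
    then have "c' > c" using bump_top.prems by (cases e') auto
    from bump_top.prems(1) show ?thesis
      using \<open>c' > c\<close> bump_top.prems(2,3) bump_top.hyps(1,2)
      by cases ((simp; fail) | (rule bump_top.IH, assumption, (simp; fail), (simp; fail)))+
  qed
next
  case (cross_right c r s)
  have "c' > c" using cross_right.prems by (cases e') auto
  from cross_right.prems(1) show ?case
    using \<open>c' > c\<close> cross_right.prems(2,3) cross_right.hyps(1,2)
    by cases ((simp; fail) | (rule cross_right.IH, assumption, (simp; fail), (simp; fail)))+
next
  case (bump_right c r s)
  have "c' > c" using bump_right.prems by (cases e') auto
  from bump_right.prems(1) show ?case
    using \<open>c' > c\<close> bump_right.prems(2,3) bump_right.hyps(1,2)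
    by cases ((simp; fail) | (rule bump_right.IH, assumption, (simp; fail), (simp; fail)))+
qed

text \<open>A discrete intermediate value argument: each tile raises \<open>r - c\<close> by one,
  from at most \<open>1 - u\<close> to at least 1 at the boundary. The diagonal is the one through
  the entry \<open>(1, u)\<close> of another pipe.\<close>

lemma exits_reaches_diagonal:
  assumes "exits D e r c a" "r \<ge> 1" "u \<ge> 1" "r + u \<le> 1 + c"
  shows "\<exists>e' r' c'. exits D e' r' c' a \<and> r' \<ge> 1 \<and> r' + u = 1 + c'"
  using assms
proof (induction rule: exits.induct)
  case (boundary r) then show ?case by auto
next
  case (cross_top c r s)
  then show ?case using exits.cross_top[of c r D s] by (cases "r + u = 1 + c") auto
next
  case (cross_right c r s)
  then show ?case using exits.cross_right[of c r D s] by (cases "r + u = 1 + c") auto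
next
  case (bump_top c r s)
  then show ?case using exits.bump_top[of c r D s] by (cases "r + u = 1 + c") auto
next
  case (bump_right c r s)
  then show ?case using exits.bump_right[of c r D s] by (cases "r + u = 1 + c") auto
qed

section \<open>Crosses and inversions\<close>

lemma inversion_crosses:
  assumes "has_perm D w" "(a, b) \<in> inversions w"
  shows "\<exists>x\<in>D. strands D x = {a, b}"
proof -
  have ab: "1 \<le> a" "a < b" "w b < w a" using assms by (auto simp: inversions_def)
  have a: "exits D TopEdge 1 (w a) a" and b: "exits D TopEdge 1 (w b) b" and "w b \<ge> 1"
    using assms(1) ab by (auto simp: has_perm_def)
  \<comment> \<open>Pipe \<open>a\<close> enters to the right of pipe \<open>b\<close>, so it is
    followed to the diagonal where \<open>b\<close> starts. There it sits on a different edge, hence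
    further right, yet it exits in the higher row.\<close>
  obtain e r c where e: "exits D e r c a" "r \<ge> 1" "r + w b = 1 + c"
    using exits_reaches_diagonal[OF a, of "w b"] ab \<open>w b \<ge> 1\<close> by auto
  have "\<not> (e = TopEdge \<and> r = 1)"
    using exits_unique[OF b] e ab by auto
  then have "edge_pos TopEdge (w b) < edge_pos e c"
    using e by (cases e) auto
  then show ?thesis using exits_order[OF b e(1)] e ab by (auto simp: insert_commute)
qed

text \<open>The \<open>card D\<close> pairs coming from inversions all occur among the at most
  \<open>card D\<close> labels of crosses. So these pairs are all the labels, and no label
  repeats.\<close>

lemma RPD_strands:
  assumes "D \<in> RPD w"
  shows "inj_on (strands D) D" and "strands D ` D = (\<lambda>(a, b). {a, b}) ` inversions w"
proof -
  let ?I = "(\<lambda>(a, b). {a, b}) ` inversions w"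
  have D: "finite D" "has_perm D w" "card D = card (inversions w)"
    using assms by (auto simp: RPD_def pipe_dream_def)
  have sub: "?I \<subseteq> strands D ` D"
    using inversion_crosses[OF D(2)] by (force simp: image_iff)
  have "inj_on (\<lambda>(a, b). {a, b}) (inversions w)"
    by (auto simp: inj_on_def inversions_def doubleton_eq_iff)
  then have card: "card ?I = card D" using D by (simp add: card_image)
  show eq: "strands D ` D = ?I"
    using card_image_le[OF D(1), of "strands D"] card card_mono[OF finite_imageI[OF D(1)] sub]
    by (intro card_subset_eq[symmetric] finite_imageI D sub) linarith
  show "inj_on (strands D) D"
    using eq card D by (intro eq_card_imp_inj_on) auto
qed

section \<open>Consequences of reducedness for the shape of the tiling\<close>

lemma exits_right_through:
  assumes "exits D RightEdge r b s" "b \<le> k" "\<And>c. b < c \<Longrightarrow> c \<le> k \<Longrightarrow> (r, c) \<in> D"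
  shows "exits D RightEdge r k s"
  using assms(2,3)
proof (induction rule: dec_induct)
  case base show ?case by (rule assms)
next
  case (step m)
  then show ?case using exits.cross_right[of "Suc m" r D s] by auto
qed

lemma exits_top_through:
  assumes "exits D TopEdge i c s" "a \<le> i" "c \<ge> 1" "\<And>r. a \<le> r \<Longrightarrow> r < i \<Longrightarrow> (r, c) \<in> D"
  shows "exits D TopEdge a c s"
  using assms(2,4)
proof (induction rule: inc_induct)
  case base show ?case by (rule assms)
next
  case (step m)
  then show ?case using exits.cross_top[of c m D s] assms(3) by auto
qed

text \<open>All that the later induction uses of reducedness, separated from pipes and
  permutations.\<close>

definition no_double_crossing_rect :: "tiling \<Rightarrow> bool" where
  "no_double_crossing_rect D \<longleftrightarrow> (\<forall>a i b k. a < i \<longrightarrow> 1 \<le> b \<longrightarrow> b < k \<longrightarrow> (a, b) \<notin> D \<longrightarrow> (i, k) \<notin> D \<longrightarrow>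
     \<not> {a..i} \<times> {b..k} - {(a, b), (i, k)} \<subseteq> D)"

text \<open>Otherwise the same two strands would cross at \<open>(a, k)\<close> and at \<open>(i, b)\<close>.\<close>

lemma RPD_no_double_crossing_rect:
  assumes "D \<in> RPD w"
  shows "no_double_crossing_rect D"
  unfolding no_double_crossing_rect_def
proof (intro allI impI notI)
  fix a i b k
  assume *: "a < i" "1 \<le> b" "b < k" "(a, b) \<notin> D" "(i, k) \<notin> D"
    and sub: "{a..i} \<times> {b..k} - {(a, b), (i, k)} \<subseteq> D"
  have D: "(r, c) \<in> D" if "a \<le> r" "r \<le> i" "b \<le> c" "c \<le> k" "(r, c) \<noteq> (a, b)" "(r, c) \<noteq> (i, k)" for r c
    using sub that by auto
  have fin: "finite D" using assms by (auto simp: RPD_def pipe_dream_def)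
  obtain s where s: "exits D RightEdge i b s" using exits_total(1)[OF fin] by blast
  obtain t where t: "exits D TopEdge i b t" using exits_total(2)[OF fin] * by blast
  \<comment> \<open>Both pipes at \<open>(i, b)\<close> are traced backwards. Pipe \<open>s\<close>
    comes along row \<open>i\<close> from the bump \<open>(i, k)\<close>, reached down column
    \<open>k\<close>; pipe \<open>t\<close> comes down column \<open>b\<close> from the bump
    \<open>(a, b)\<close>, reached along row \<open>a\<close>. Both pass through
    \<open>(a, k)\<close>.\<close>
  have "exits D RightEdge i (k - 1) s"
    by (rule exits_right_through[OF s]; (rule D)?) (use * in auto)
  then have s1: "exits D TopEdge i k s" using * by (intro exits.bump_top) auto
  have s': "exits D TopEdge a k s"
    by (rule exits_top_through[OF s1]; (rule D)?) (use * in auto)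
  have "exits D TopEdge (a + 1) b t"
    by (rule exits_top_through[OF t]; (rule D)?) (use * in auto)
  then have t1: "exits D RightEdge a b t" using * by (intro exits.bump_right) auto
  have t': "exits D RightEdge a k t"
    by (rule exits_right_through[OF t1]; (rule D)?) (use * in auto)
  have "strands D (a, k) = strands D (i, b)"
    using strands_eq[OF s' t'] strands_eq[OF t s] by auto
  moreover have "(a, k) \<in> D" "(i, b) \<in> D" using * by (auto intro: D)
  ultimately show False using RPD_strands(1)[OF assms] * by (auto dest: inj_onD)
qed

text \<open>Every tile met is a bump, so the pipe descends a staircase alternating between the
  antidiagonals of sum \<open>r + c\<close> and \<open>r + c - 1\<close>.\<close>

lemma exits_below_crosses:
  assumes "\<And>x y. (x, y) \<in> D \<Longrightarrow> r \<le> x \<Longrightarrow> x + y + 1 < r + c" "c \<ge> 1"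
  shows "exits D TopEdge r c (r + c - 1)"
  using assms(2,1)
proof (induction c arbitrary: r rule: dec_induct)
  case base
  then show ?case by (auto intro!: exits.bump_top exits.boundary)
next
  case (step c)
  have "exits D TopEdge (r + 1) c (r + 1 + c - 1)"
  proof (rule step.IH)
    fix x y assume "(x, y) \<in> D" "r + 1 \<le> x"
    then show "x + y + 1 < r + 1 + c" using step.prems[of x y] by auto
  qed
  moreover have "(r, c) \<notin> D" "(r, Suc c) \<notin> D"
    using step.prems[of r c] step.prems[of r "Suc c"] by auto
  ultimately show ?case
    using step.hyps exits.bump_right[of c r D] exits.bump_top[of "Suc c" r D] by auto
qed

text \<open>On the outermost antidiagonal with crosses, of sum \<open>s\<close>, the pipe leaving
  the lowest cross downwards meets only bumps and exits in row \<open>s\<close>. If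
  \<open>s > n\<close>, an inversion would involve an index beyond \<open>n\<close>, but
  \<open>w\<close> fixes these and maps the others to values at most \<open>n\<close>.\<close>

lemma RPD_cross_le:
  assumes "w permutes {1..n}" "D \<in> RPD w" "(r, c) \<in> D"
  shows "r + c \<le> n"
proof (rule ccontr)
  assume "\<not> r + c \<le> n"
  have D: "finite D" "D \<subseteq> {1..} \<times> {1..}" using assms by (auto simp: RPD_def pipe_dream_def)
  define s where "s = Max ((\<lambda>(x, y). x + y) ` D)"
  have s: "x + y \<le> s" if "(x, y) \<in> D" for x y
    unfolding s_def by (rule Max_ge) (use that D in force)+
  have "s \<in> (\<lambda>(x, y). x + y) ` D"
    unfolding s_def by (rule Max_in) (use assms(3) D in auto)
  then obtain x0 y0 where 0: "(x0, y0) \<in> D" "x0 + y0 = s" by auto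
  define x where "x = Max {x. (x, s - x) \<in> D}"
  have fin: "finite {x. (x, s - x) \<in> D}"
    by (rule finite_subset[of _ "fst ` D"]) (use D in force)+
  have "x0 \<in> {x. (x, s - x) \<in> D}" using 0 by auto
  then have "x \<in> {x. (x, s - x) \<in> D}" unfolding x_def by (intro Max_in[OF fin]) auto
  then have x: "(x, s - x) \<in> D" by simp
  have xmax: "x' \<le> x" if "(x', s - x') \<in> D" for x'
    unfolding x_def using that by (intro Max_ge[OF fin]) auto
  have xs: "1 \<le> x" "1 \<le> s - x" "x < s" using x D by auto
  have "exits D TopEdge (x + 1) (s - x) (x + 1 + (s - x) - 1)"
  proof (rule exits_below_crosses)
    fix x' y assume "(x', y) \<in> D" "x + 1 \<le> x'"
    moreover from this have "x' + y \<noteq> s" using xmax[of x'] by auto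
    ultimately show "x' + y + 1 < x + 1 + (s - x)" using s[of x' y] xs by auto
  qed (use xs in auto)
  then have top: "exits D TopEdge x (s - x) s" using exits.cross_top[OF xs(2) x] xs by simp
  obtain t where "exits D RightEdge x (s - x) t" using exits_total(1)[OF D(1)] by blast
  with top have "strands D (x, s - x) = {s, t}" by (rule strands_eq)
  moreover have "strands D (x, s - x) \<in> strands D ` D" using x by (rule imageI)
  ultimately have "{s, t} \<in> (\<lambda>(a, b). {a, b}) ` inversions w"
    by (simp only: RPD_strands(2)[OF assms(2)])
  then obtain a b where ab: "(a, b) \<in> inversions w" "{s, t} = {a, b}" by auto
  have "s > n" using s[OF assms(3)] \<open>\<not> r + c \<le> n\<close> by auto
  then have "b > n" "a < b" "w b < w a" using ab by (auto simp: inversions_def doubleton_eq_iff)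
  moreover from this have "w b = b" using permutes_not_in[OF assms(1), of b] by auto
  moreover have "w a = a \<or> w a \<le> n"
    using permutes_not_in[OF assms(1), of a] permutes_in_image[OF assms(1), of a] by force
  ultimately show False by auto
qed

section \<open>The move operator and the path\<close>

text \<open>Describes the corners by tile conditions in place of \<open>Max\<close> and
  \<open>Min\<close>, so that they transfer to intermediate tilings; \<open>k \<le> n\<close> lets
  \<open>kcol\<close> find \<open>k\<close>.\<close>

definition spans :: "nat \<Rightarrow> tiling \<Rightarrow> nat \<Rightarrow> nat \<Rightarrow> nat \<Rightarrow> nat \<Rightarrow> bool" where
  "spans n D i j h k \<longleftrightarrow> 1 \<le> h \<and> h < i \<and> 1 \<le> j \<and> j < k \<and> k \<le> n \<and> (h, j) \<notin> D \<and> (i, k) \<notin> D \<and>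
     (\<forall>r. h < r \<longrightarrow> r \<le> i \<longrightarrow> (r, j) \<in> D) \<and> (\<forall>c. j \<le> c \<longrightarrow> c < k \<longrightarrow> (i, c) \<in> D)"

section \<open>Identifying the parameters of a move\<close>

lemma hrow_eqI:
  assumes "1 \<le> h" "h < i" "(h, j) \<notin> D" "\<And>r. h < r \<Longrightarrow> r < i \<Longrightarrow> (r, j) \<in> D"
  shows "hrow D i j = h"
proof -
  have "r \<le> h" if "r < i" "(r, j) \<notin> D" for r using assms(4)[of r] that by linarith
  with assms(1-3) show ?thesis unfolding hrow_def by (intro Max_eqI) auto
qed

lemma kcol_eqI:
  assumes "j < k" "k \<le> n" "(i, k) \<notin> D" "\<And>c. j < c \<Longrightarrow> c < k \<Longrightarrow> (i, c) \<in> D"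
  shows "kcol n D i j = k"
proof -
  have "k \<le> c" if "j < c" "(i, c) \<notin> D" for c using assms(4)[of c] that by linarith
  with assms(1-3) show ?thesis unfolding kcol_def by (intro Min_eqI) auto
qed

lemma spansD:
  assumes "spans n D i j h k"
  shows "hrow D i j = h" "kcol n D i j = k" "movable D i j"
proof -
  show "hrow D i j = h" by (rule hrow_eqI) (use assms in \<open>auto simp: spans_def\<close>)
  show "kcol n D i j = k" by (rule kcol_eqI) (use assms in \<open>auto simp: spans_def\<close>)
  show "movable D i j"
    using assms by (auto simp: spans_def movable_def intro!: bexI[of _ h])
qed

lemma maxrow_eqI:
  assumes "spans n D i j h k" "h \<le> a" "a < i" "j \<le> c" "c \<le> k" "(a, c) \<notin> D"
    and "\<And>r c. a < r \<Longrightarrow> r < i \<Longrightarrow> j \<le> c \<Longrightarrow> c \<le> k \<Longrightarrow> (r, c) \<in> D"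
  shows "maxrow n D i j = a"
proof -
  have "r \<le> a" if "r < i" "j \<le> c" "c \<le> k" "(r, c) \<notin> D" for r c
    using assms(7)[of r c] that by linarith
  with assms(1-6) show ?thesis
    unfolding maxrow_def rect_def spansD[OF assms(1)] by (intro Max_eqI) auto
qed

lemma mincol_eqI:
  assumes "spans n D i j h k" "j < b" "b \<le> k" "h \<le> r" "r \<le> i" "(r, b) \<notin> D"
    and "\<And>r c. h \<le> r \<Longrightarrow> r \<le> i \<Longrightarrow> j < c \<Longrightarrow> c < b \<Longrightarrow> (r, c) \<in> D"
  shows "mincol n D i j = b"
proof -
  have "b \<le> c" if "h \<le> r" "r \<le> i" "j < c" "(r, c) \<notin> D" for r c
    using assms(7)[of r c] that by linarith
  with assms(1-6) show ?thesis
    unfolding mincol_def rect_def spansD[OF assms(1)] by (intro Min_eqI) auto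
qed

text \<open>Of two different candidates, one has a corner bump in column \<open>j\<close> or row
  \<open>i\<close> strictly between two corners of the other, where only crosses are
  allowed.\<close>

lemma ladder_move_eq:
  assumes "ladder_rect D i j h k"
  shows "ladder_move i j D = insert (h, k) (D - {(i, j)})"
proof -
  have unique: "h' = h \<and> k' = k" if "ladder_rect D i j h' k'" for h' k'
  proof -
    note d = assms[unfolded ladder_rect_def] that[unfolded ladder_rect_def]
    have "\<not> h < h'" "\<not> h' < h" "\<not> k < k'" "\<not> k' < k"
      using d by (auto simp: subset_iff)
    then show ?thesis by auto
  qed
  have "(THE (h, k). ladder_rect D i j h k) = (h, k)"
    by (rule the_equality) (use assms in \<open>auto dest: unique\<close>)
  then show ?thesis by (simp add: ladder_move_def)
qed

section \<open>Moves in a rectangle whose bumps lie in its top and bottom rows\<close>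

lemma move_ladder:
  assumes "spans n D i j h k" "(h, k) \<notin> D"
    and "\<And>r c. h \<le> r \<Longrightarrow> r \<le> i \<Longrightarrow> j < c \<Longrightarrow> c < k \<Longrightarrow> (r, c) \<in> D"
    and "\<And>r. h < r \<Longrightarrow> r < i \<Longrightarrow> (r, k) \<in> D"
  shows "move_dom (n, i, j, D)" "move n i j D = insert (h, k) (D - {(i, j)})"
proof -
  note s = assms(1)[unfolded spans_def]
  have crosses: "(r, c) \<in> D" if "h < r" "r < i" "j \<le> c" "c \<le> k" for r c
    using that assms(3)[of r c] assms(4)[of r] s by (cases "c = k"; cases "c = j") auto
  have a: "maxrow n D i j = h"
    by (rule maxrow_eqI[OF assms(1), of _ k]) (use assms crosses s in auto)
  have b: "mincol n D i j = k"
    by (rule mincol_eqI[OF assms(1), of _ h]) (use assms s in auto)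
  show dom: "move_dom (n, i, j, D)"
    by (rule move.domintros) (use a b spansD[OF assms(1)] in auto)
  have "{h..i} \<times> {j..k} - {(i, j), (h, j), (i, k), (h, k)} \<subseteq> D"
  proof (rule subrelI)
    fix r c assume "(r, c) \<in> {h..i} \<times> {j..k} - {(i, j), (h, j), (i, k), (h, k)}"
    then show "(r, c) \<in> D"
      using crosses[of r c] assms(3)[of r c] by (cases "c = j \<or> c = k") auto
  qed
  with assms(2) s have "ladder_rect D i j h k" unfolding ladder_rect_def by auto
  then show "move n i j D = insert (h, k) (D - {(i, j)})"
    using a b spansD[OF assms(1)] by (simp add: move.psimps[OF dom] ladder_move_eq)
qed

text \<open>Induction on the width: row \<open>h\<close> is cleared from the right, by an inner move
  at its next bump column \<open>b\<close> followed by a single ladder move. Domain and value are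
  proved together because \<open>move.psimps\<close> holds on the domain only.\<close>

lemma move_row:
  assumes "spans n D i j h k" "(h, k) \<notin> D" "{h<..<i} \<times> {j..k} \<subseteq> D"
  shows "move_dom (n, i, j, D) \<and>
    move n i j D = (D - {(i, c) |c. j \<le> c \<and> c < k \<and> (h, c) \<notin> D}) \<union> {(h, c) |c. j < c \<and> c \<le> k}"
  using assms
proof (induction "k - j" arbitrary: j rule: less_induct)
  case less
  note s = less.prems(1)[unfolded spans_def]
  have between: "(r, c) \<in> D" if "h < r" "r < i" "j \<le> c" "c \<le> k" for r c
    using less.prems(3) that by auto
  show ?case
  proof (cases "\<exists>c. j < c \<and> c < k \<and> (h, c) \<notin> D")
    case False
    have row: "(r, c) \<in> D" if "h \<le> r" "r \<le> i" "j < c" "c < k" for r c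
      using that False s between[of r c] by (cases "r = h"; cases "r = i") auto
    note m = move_ladder[OF less.prems(1,2) row between]
    have "insert (h, k) (D - {(i, j)}) =
      (D - {(i, c) |c. j \<le> c \<and> c < k \<and> (h, c) \<notin> D}) \<union> {(h, c) |c. j < c \<and> c \<le> k}"
    proof -
      have "j \<le> c \<and> c < k \<and> (h, c) \<notin> D \<longleftrightarrow> c = j" for c
        using False s by (cases "c = j") auto
      moreover have "j < c \<and> c \<le> k \<longrightarrow> c = k \<or> (h, c) \<in> D" for c
        using False by (cases "c = k") auto
      ultimately show ?thesis using s by auto
    qed
    with m s show ?thesis by auto
  next
    case True
    define b where "b = (LEAST c. j < c \<and> (h, c) \<notin> D)"
    from True have b: "j < b" "(h, b) \<notin> D"
      unfolding b_def by (metis (mono_tags, lifting) LeastI)+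
    have bk: "b < k" using True Least_le[of "\<lambda>c. j < c \<and> (h, c) \<notin> D"] unfolding b_def
      by (metis (mono_tags, lifting) le_less_trans)
    have bmin: "(h, c) \<in> D" if "j < c" "c < b" for c
      using not_less_Least[of c "\<lambda>c. j < c \<and> (h, c) \<notin> D"] that unfolding b_def by blast
    have row: "(r, c) \<in> D" if "h \<le> r" "r \<le> i" "j < c" "c < b" for r c
      using that bk bmin s between[of r c] by (cases "r = h"; cases "r = i") auto
    have a: "maxrow n D i j = h"
      by (rule maxrow_eqI[OF less.prems(1), of _ k]) (use less.prems(2) between s in auto)
    have m: "mincol n D i j = b"
      by (rule mincol_eqI[OF less.prems(1), of _ h]) (use b bk row s in auto)
    have col: "(r, b) \<in> D" if "h < r" "r \<le> i" for r
      using that bk b s between[of r b] by (cases "r = i") auto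
    have spb: "spans n D i b h k"
      using s b bk col unfolding spans_def by auto
    define D1 where
      "D1 = (D - {(i, c) |c. b \<le> c \<and> c < k \<and> (h, c) \<notin> D}) \<union> {(h, c) |c. b < c \<and> c \<le> k}"
    have sub: "{h<..<i} \<times> {b..k} \<subseteq> D" using less.prems(3) b by auto
    have D1: "move_dom (n, i, b, D)" "move n i b D = D1"
      using less.hyps[OF _ spb less.prems(2) sub] b bk by (simp_all add: D1_def)
    \<comment> \<open>The inner move turns \<open>(i, b)\<close> into a bump and leaves
      \<open>(h, b)\<close> one, so the rectangle at \<open>(i, j)\<close> now ends in column
      \<open>b\<close> and case (i) of the recursion applies.\<close>
    have sp1: "spans n D1 i j h b"
      using s b bk unfolding spans_def D1_def by auto
    have dom1: "move_dom (n, i, j, D1)" and m1: "move n i j D1 = insert (h, b) (D1 - {(i, j)})"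
      by (rule move_ladder[OF sp1];
          use b bk s row col between in \<open>auto simp: D1_def\<close>)+
    have dom: "move_dom (n, i, j, D)"
      by (rule move.domintros) (use a m D1 dom1 spansD[OF less.prems(1)] in auto)
    have "move n i j D = insert (h, b) (D1 - {(i, j)})"
      using a m D1 bk m1 spansD[OF less.prems(1)] by (simp add: move.psimps[OF dom])
    also have "\<dots> = (D - {(i, c) |c. j \<le> c \<and> c < k \<and> (h, c) \<notin> D}) \<union> {(h, c) |c. j < c \<and> c \<le> k}"
    proof (rule set_eqI)
      fix p :: "nat \<times> nat"
      obtain r c where p: "p = (r, c)" by (cases p)
      consider "c < j" | "c = j" | "j < c" "c < b" | "c = b" | "b < c" by linarith
      then show "p \<in> insert (h, b) (D1 - {(i, j)}) \<longleftrightarrow>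
        p \<in> (D - {(i, c) |c. j \<le> c \<and> c < k \<and> (h, c) \<notin> D}) \<union> {(h, c) |c. j < c \<and> c \<le> k}"
        by cases (use p s b bk bmin[of c] in \<open>auto simp: D1_def\<close>)
    qed
    finally show ?thesis using dom by blast
  qed
qed

section \<open>Recursive structure of the path\<close>

lemma first_bump_eqI:
  assumes "j \<le> q" "(p, q) \<notin> D" "\<And>t. j \<le> t \<Longrightarrow> t < q \<Longrightarrow> (p, t) \<in> D"
  shows "first_bump D p j = q"
proof -
  have "q \<le> t" if "j \<le> t" "(p, t) \<notin> D" for t using assms(3)[of t] that by linarith
  with assms(1,2) show ?thesis unfolding first_bump_def by (intro Least_equality) auto
qed

text \<open>The successor of a state depends on its row only. After one round the loop thus runs as
  if begun in row \<open>a\<close>, provided \<open>kcol\<close> there returns the column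
  \<open>q\<close> just reached.\<close>

lemma path_state_unfold:
  assumes "a = maxrow n D i j" "q = first_bump D a j" "q \<noteq> j \<Longrightarrow> kcol n D a j = q"
  shows "path_state n D i j =
    insert (i, kcol n D i j) (if q = j then {} else path_state n D a j)"
proof -
  have sub: "x \<in> insert (i, kcol n D i j) (if q = j then {} else path_state n D a j)"
    if "x \<in> path_state n D i j" for x
    using that
  proof (cases x)
    case (Pair p q)
    from that show ?thesis unfolding Pair
    proof (induction rule: path_state.induct)
      case start show ?case by simp
    next
      case (again p q p' q')
      then show ?case using assms path_state.start[of a n D j]
        by (auto split: if_splits intro: path_state.again)
    qed
  qed
  have sup: "(p, q') \<in> path_state n D i j" if "(p, q') \<in> path_state n D a j" "q \<noteq> j" for p q'
    using that
  proof (induction rule: path_state.induct)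
    case start
    then show ?case
      using path_state.again[OF path_state.start assms(1,2)] assms(3) by simp
  next
    case (again p q p' q')
    then show ?case by (auto intro: path_state.again)
  qed
  show ?thesis
  proof (intro equalityI subsetI)
    fix x assume "x \<in> insert (i, kcol n D i j) (if q = j then {} else path_state n D a j)"
    then consider "x = (i, kcol n D i j)" | "q \<noteq> j" "x \<in> path_state n D a j"
      by (metis emptyE insertE)
    then show "x \<in> path_state n D i j"
      by cases (use path_state.start[of i n D j] sup[of "fst x" "snd x"] in simp_all)
  qed (rule sub)
qed

lemma path_unfold:
  assumes "a = maxrow n D i j" "q = first_bump D a j" "q \<noteq> j \<Longrightarrow> kcol n D a j = q"
    and "q \<le> kcol n D i j" "a < i"
  shows "path n D i j = {(i, kcol n D i j)} \<union> {a..<i} \<times> {kcol n D i j} \<union> {a} \<times> {q..<kcol n D i j} \<union>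
    (if q = j then {} else path n D a j)"
proof -
  let ?k = "kcol n D i j"
  let ?S = "\<Union>(p, q)\<in>path_state n D a j. step_A n D j p q \<union> step_B n D j p q"
  define V where "V = {a..<i} \<times> {?k} \<union> {a} \<times> {q..<?k}"
  \<comment> \<open>The path begun in row \<open>a\<close> lists \<open>(a, q)\<close> again. This
    point is already on the horizontal segment if \<open>q < ?k\<close>, and is the top of the
    vertical one if \<open>q = ?k\<close>.\<close>
  have V: "(a, q) \<in> V" using assms by (auto simp: V_def)
  have states: "path_state n D i j = insert (i, ?k) (if q = j then {} else path_state n D a j)"
    by (rule path_state_unfold) (use assms in auto)
  have i: "path n D i j = {(i, ?k)} \<union> (V \<union> (if q = j then {} else ?S))"
    unfolding path_def states
    by (simp add: step_A_def step_B_def V_def assms(1)[symmetric] assms(2)[symmetric])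
  have a: "path n D a j = insert (a, q) ?S" if "q \<noteq> j"
    unfolding path_def using assms(3)[OF that] by simp
  have "path n D i j = {(i, ?k)} \<union> V \<union> (if q = j then {} else path n D a j)"
  proof (cases "q = j")
    case False
    have "{(i, ?k)} \<union> (V \<union> S) = {(i, ?k)} \<union> V \<union> insert (a, q) S" for S
      using V by blast
    then show ?thesis by (simp only: i a[OF False] False if_False)
  qed (simp add: i)
  then show ?thesis by (simp only: V_def Un_assoc)
qed

section \<open>Rectangles in reduced pipe dreams\<close>

lemma obtain_spans:
  assumes "w permutes {1..n}" "D \<in> RPD w" "movable D i j"
  obtains h k where "spans n D i j h k"
proof -
  have ij: "(i, j) \<in> D" and "\<exists>h\<in>{1..i - 1}. (h, j) \<notin> D"
    using assms(3) by (auto simp: movable_def)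
  then obtain h0 where h0: "1 \<le> h0" "h0 < i" "(h0, j) \<notin> D" by force
  have j: "1 \<le> j" using assms(2) ij by (auto simp: RPD_def pipe_dream_def)
  have le: "r + c \<le> n" if "(r, c) \<in> D" for r c using RPD_cross_le[OF assms(1,2) that] .
  define H where "H = {r. 1 \<le> r \<and> r < i \<and> (r, j) \<notin> D}"
  have H: "finite H" "H \<noteq> {}" using h0 by (auto simp: H_def)
  define h where "h = Max H"
  have h: "h \<in> H" "\<And>r. r \<in> H \<Longrightarrow> r \<le> h"
    using H Max_in[of H] Max_ge[of H] by (auto simp: h_def)
  \<comment> \<open>\<open>(i, n + 1 - i)\<close> lies just outside the staircase of
    \<open>RPD_cross_le\<close>, so it is a bump within the range searched by
    \<open>kcol\<close>.\<close>
  have k0: "j < n + 1 - i" "n + 1 - i \<le> n" "(i, n + 1 - i) \<notin> D"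
    using le[OF ij] h0 le[of i "n + 1 - i"] by auto
  define k where "k = (LEAST c. j < c \<and> (i, c) \<notin> D)"
  have k: "j < k" "(i, k) \<notin> D" "k \<le> n"
    using LeastI[of "\<lambda>c. j < c \<and> (i, c) \<notin> D" "n + 1 - i"]
      Least_le[of "\<lambda>c. j < c \<and> (i, c) \<notin> D" "n + 1 - i"] k0 by (auto simp: k_def)
  have k': "(i, c) \<in> D" if "j < c" "c < k" for c
    using not_less_Least[of c "\<lambda>c. j < c \<and> (i, c) \<notin> D"] that by (auto simp: k_def)
  have "(r, j) \<in> D" if "h < r" "r \<le> i" for r
    using h(2)[of r] that ij h(1) by (cases "r = i") (auto simp: H_def)
  moreover have "(i, c) \<in> D" if "j \<le> c" "c < k" for c
    using k'[of c] that ij by (cases "c = j") auto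
  ultimately have "spans n D i j h k"
    using h(1) k j by (auto simp: spans_def H_def)
  then show thesis by (rule that)
qed

text \<open>
  The last row above \<open>i\<close> with a bump in the rectangle has one in column \<open>k\<close>: a rightmost bump
  \<open>(a, b)\<close> with \<open>b < k\<close> would span a rectangle of double crossings with \<open>(i, k)\<close>.
\<close>

lemma spans_maxrow:
  assumes "spans n D i j h k" "no_double_crossing_rect D"
  obtains a where "h \<le> a" "a < i" "maxrow n D i j = a" "(a, k) \<notin> D"
    "{a<..<i} \<times> {j..k} \<subseteq> D"
    "a = h \<or> (\<exists>q. spans n D a j h q \<and> q \<le> k)"
proof -
  note s = assms(1)[unfolded spans_def]
  define A where "A = {p. h \<le> p \<and> p < i \<and> (\<exists>c. j \<le> c \<and> c \<le> k \<and> (p, c) \<notin> D)}"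
  have "h \<in> A" using s by (auto simp: A_def)
  then have A: "finite A" "A \<noteq> {}" by (auto simp: A_def)
  define a where "a = Max A"
  have aA: "a \<in> A" and amax: "\<And>p. p \<in> A \<Longrightarrow> p \<le> a"
    using A Max_in[of A] Max_ge[of A] by (auto simp: a_def)
  have a: "h \<le> a" "a < i" using aA by (auto simp: A_def)
  have between: "(r, c) \<in> D" if "a < r" "r < i" "j \<le> c" "c \<le> k" for r c
    using amax[of r] that a by (auto simp: A_def)
  define C where "C = {c. j \<le> c \<and> c \<le> k \<and> (a, c) \<notin> D}"
  have C: "finite C" "C \<noteq> {}" using aA by (auto simp: A_def C_def)
  define b where "b = Max C"
  have bC: "b \<in> C" and bmax: "\<And>c. c \<in> C \<Longrightarrow> c \<le> b"
    using C Max_in[of C] Max_ge[of C] by (auto simp: b_def)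
  have b: "j \<le> b" "b \<le> k" "(a, b) \<notin> D" using bC by (auto simp: C_def)
  have "b = k"
  proof (rule ccontr)
    assume "b \<noteq> k"
    then have "b < k" using b by auto
    have "{a..i} \<times> {b..k} - {(a, b), (i, k)} \<subseteq> D"
    proof (rule subrelI)
      fix r c assume rc: "(r, c) \<in> {a..i} \<times> {b..k} - {(a, b), (i, k)}"
      consider "r = a" | "r = i" | "a < r" "r < i" using rc by fastforce
      then show "(r, c) \<in> D"
      proof cases
        case 1
        then show ?thesis using rc bmax[of c] b by (auto simp: C_def)
      next
        case 2
        then show ?thesis using rc b s a by auto
      next
        case 3
        then show ?thesis using rc b between[of r c] by auto
      qed
    qed
    then show False
      using assms(2) s b \<open>b < k\<close> a unfolding no_double_crossing_rect_def
      by (meson le_trans)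
  qed
  have max: "maxrow n D i j = a"
    by (rule maxrow_eqI[OF assms(1) a b between])
  have next_span: "\<exists>q. spans n D a j h q \<and> q \<le> k" if "a \<noteq> h"
  proof -
    have aj: "(a, j) \<in> D" using that a s by auto
    \<comment> \<open>Column \<open>j\<close> has only crosses from below \<open>h\<close> down to
      \<open>i\<close>, so the rectangle at \<open>(a, j)\<close> keeps its top row
      \<open>h\<close>; the leftmost bump of row \<open>a\<close> is its right end.\<close>
    define q where "q = Min C"
    have qC: "q \<in> C" and qmin: "\<And>c. c \<in> C \<Longrightarrow> q \<le> c"
      using C Min_in[of C] Min_le[of C] by (auto simp: q_def)
    have "(a, c) \<in> D" if "j \<le> c" "c < q" for c
      using qmin[of c] that qC by (auto simp: C_def)
    moreover have "j \<noteq> q" using qC aj by (auto simp: C_def)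
    ultimately have "spans n D a j h q"
      using that a s qC by (auto simp: spans_def C_def)
    then show ?thesis using qC by (auto simp: C_def)
  qed
  have "{a<..<i} \<times> {j..k} \<subseteq> D" using between by auto
  then show thesis
    using that[OF a max] b \<open>b = k\<close> next_span by blast
qed

section \<open>The procedure in terms of the bumps on the path\<close>

lemma path_last:
  assumes "spans n D i j h k" "maxrow n D i j = h"
  shows "path n D i j = {(i, k)} \<union> {h..<i} \<times> {k} \<union> {h} \<times> {j..<k}"
proof -
  note s = assms(1)[unfolded spans_def]
  have "first_bump D h j = j" by (rule first_bump_eqI) (use s in auto)
  then have "path n D i j = {(i, kcol n D i j)} \<union> {h..<i} \<times> {kcol n D i j} \<union>
      {h} \<times> {j..<kcol n D i j} \<union> (if j = j then {} else path n D h j)"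
    by (intro path_unfold) (use assms s spansD[OF assms(1)] in auto)
  then show ?thesis by (simp add: spansD[OF assms(1)])
qed

lemma path_step:
  assumes "spans n D i j h k" "maxrow n D i j = a" "spans n D a j h q" "q \<le> k" "a < i"
  shows "path n D i j = {(i, k)} \<union> {a..<i} \<times> {k} \<union> {a} \<times> {q..<k} \<union> path n D a j"
proof -
  note s = assms(3)[unfolded spans_def]
  have "first_bump D a j = q" by (rule first_bump_eqI) (use s in auto)
  then have "path n D i j = {(i, kcol n D i j)} \<union> {a..<i} \<times> {kcol n D i j} \<union>
      {a} \<times> {q..<kcol n D i j} \<union> (if q = j then {} else path n D a j)"
    by (intro path_unfold) (use assms s spansD[OF assms(1)] spansD[OF assms(3)] in auto)
  then show ?thesis using s by (simp add: spansD[OF assms(1)])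
qed

text \<open>Since the path meets column \<open>j\<close> and row \<open>i\<close> in its endpoints
  only, the deletions of steps (i) and (ii) cannot interfere with step (iii).\<close>

lemma path_endpoints:
  assumes "spans n D i j h k" "no_double_crossing_rect D"
  shows "(h, j) \<in> path n D i j" "(i, k) \<in> path n D i j"
    and "(r, c) \<in> path n D i j \<Longrightarrow> h \<le> r \<and> r \<le> i \<and> j \<le> c \<and> c \<le> k"
    and "(r, j) \<in> path n D i j \<Longrightarrow> r = h"
    and "(i, c) \<in> path n D i j \<Longrightarrow> c = k"
proof -
  have "(h, j) \<in> path n D i j \<and> (i, k) \<in> path n D i j \<and>
    (\<forall>r c. (r, c) \<in> path n D i j \<longrightarrow>
      h \<le> r \<and> r \<le> i \<and> j \<le> c \<and> c \<le> k \<and> (c = j \<longrightarrow> r = h) \<and> (r = i \<longrightarrow> c = k))"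
    using assms(1)
  proof (induction i arbitrary: k rule: less_induct)
    case (less i)
    note s = less.prems[unfolded spans_def]
    obtain a where a: "h \<le> a" "a < i" "maxrow n D i j = a"
      "a = h \<or> (\<exists>q. spans n D a j h q \<and> q \<le> k)"
      using spans_maxrow[OF less.prems assms(2)] by metis
    show ?case
    proof (cases "a = h")
      case True
      then show ?thesis using s path_last[OF less.prems] a by auto
    next
      case False
      then obtain q where q: "spans n D a j h q" "q \<le> k" using a by auto
      note IH = less.IH[OF a(2) q(1)]
      have jq: "j < q" using q by (auto simp: spans_def)
      have mem: "(r, c) \<in> path n D i j \<longleftrightarrow> (r, c) = (i, k) \<or> a \<le> r \<and> r < i \<and> c = k \<or>
          r = a \<and> q \<le> c \<and> c < k \<or> (r, c) \<in> path n D a j" for r c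
        unfolding path_step[OF less.prems a(3) q a(2)] by auto
      have sub: "h \<le> r \<and> r \<le> a \<and> j \<le> c \<and> c \<le> q \<and> (c = j \<longrightarrow> r = h)"
        if "(r, c) \<in> path n D a j" for r c
        using IH that by blast
      have "h \<le> r \<and> r \<le> i \<and> j \<le> c \<and> c \<le> k \<and> (c = j \<longrightarrow> r = h) \<and> (r = i \<longrightarrow> c = k)"
        if "(r, c) \<in> path n D i j" for r c
        using that[unfolded mem] sub[of r c] s a q(2) jq by auto
      with IH mem show ?thesis by blast
    qed
  qed
  then show "(h, j) \<in> path n D i j" "(i, k) \<in> path n D i j"
    and "(r, c) \<in> path n D i j \<Longrightarrow> h \<le> r \<and> r \<le> i \<and> j \<le> c \<and> c \<le> k"
    and "(r, j) \<in> path n D i j \<Longrightarrow> r = h"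
    and "(i, c) \<in> path n D i j \<Longrightarrow> c = k"
    by blast+
qed

lemma mem_path_procedure:
  assumes "spans n D i j h k" "no_double_crossing_rect D"
  defines "B \<equiv> path n D i j - D"
  shows "(r, c) \<in> path_procedure n i j D \<longleftrightarrow>
    (r, c) \<in> D \<and> \<not> (c = j \<and> (\<exists>c'. (r, c') \<in> B)) \<and> \<not> (r = i \<and> (\<exists>r'. (r', c) \<in> B)) \<or>
    (r, c) \<in> B \<and> (r, c) \<noteq> (h, j) \<and> (r, c) \<noteq> (i, k)"
proof -
  note p = path_endpoints[OF assms(1,2)]
  define D1 where "D1 = D - {(r, j) |r. r \<in> {h..i} \<and> (\<exists>c. (r, c) \<in> B)}"
  define D2 where "D2 = D1 - {(i, c) |c. c \<in> {j..k} \<and> (\<exists>r. (r, c) \<in> B)}"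
  have eq: "path_procedure n i j D = D2 \<union> ((path n D i j - D2) - {(h, j), (i, k)})"
    by (simp add: path_procedure_def Let_def spansD[OF assms(1)] D1_def D2_def B_def)
  have D2: "(r, c) \<in> D2 \<longleftrightarrow>
    (r, c) \<in> D \<and> \<not> (c = j \<and> (\<exists>c'. (r, c') \<in> B)) \<and> \<not> (r = i \<and> (\<exists>r'. (r', c) \<in> B))" for r c
    using p(3) unfolding D2_def D1_def B_def by auto
  \<comment> \<open>The deletions leave the path untouched: its only tiles in column
    \<open>j\<close> and row \<open>i\<close> were bumps already.\<close>
  have "(r, c) \<in> path n D i j - D2 \<and> (r, c) \<noteq> (h, j) \<and> (r, c) \<noteq> (i, k) \<longleftrightarrow>
    (r, c) \<in> B \<and> (r, c) \<noteq> (h, j) \<and> (r, c) \<noteq> (i, k)"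
    using p(4,5) D2[of r c] by (auto simp: B_def)
  with eq D2[of r c] show ?thesis by blast
qed

lemma path_bumps_last:
  assumes "spans n D i j h k" "maxrow n D i j = h" "(h, k) \<notin> D"
    and "{h<..<i} \<times> {j..k} \<subseteq> D"
  shows "(r, c) \<in> path n D i j - D \<longleftrightarrow>
    (r, c) = (i, k) \<or> r = h \<and> j \<le> c \<and> c \<le> k \<and> (h, c) \<notin> D"
proof -
  have "(r, k) \<in> D" if "h < r" "r < i" for r
    using that assms(1,4) by (auto simp: spans_def)
  then show ?thesis
    using assms(1,3) unfolding path_last[OF assms(1,2)] spans_def
    by (cases "r = h"; cases "c = k") (auto simp: le_less)
qed

text \<open>Rows strictly between \<open>a\<close> and \<open>i\<close> hold only crosses in the
  rectangle, so the first round of the loop meets bumps only at its start and in row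
  \<open>a\<close>.\<close>

lemma path_bumps_step:
  assumes "spans n D i j h k" "maxrow n D i j = a" "spans n D a j h q" "q \<le> k" "a < i"
    and "(a, k) \<notin> D"
    and "{a<..<i} \<times> {j..k} \<subseteq> D"
  shows "(r, c) \<in> path n D i j - D \<longleftrightarrow>
    (r, c) = (i, k) \<or> r = a \<and> q \<le> c \<and> c \<le> k \<and> (a, c) \<notin> D \<or> (r, c) \<in> path n D a j - D"
proof -
  have "(r, k) \<in> D" if "a < r" "r < i" for r
    using that assms(1,7) by (auto simp: spans_def)
  then show ?thesis
    using assms(1,3-6) unfolding path_step[OF assms(1-5)] spans_def
    by (cases "r = a"; cases "c = k") (auto simp: le_less)
qed

section \<open>Induction on the row of the moved tile\<close>

lemma move_eq_path_procedure:
  assumes "spans n D i j h k" "no_double_crossing_rect D"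
  shows "move_dom (n, i, j, D) \<and> move n i j D = path_procedure n i j D"
  using assms(1)
\<comment> \<open>\<open>D\<close> stays fixed: the hypothesis serves the inner move at
  \<open>(a, j)\<close>, while the outer move acts on a new tiling and is evaluated by
  \<open>move_row\<close>.\<close>
proof (induction i arbitrary: k rule: less_induct)
  case (less i)
  note s = less.prems[unfolded spans_def]
  note mem = mem_path_procedure[OF less.prems assms(2)]
  obtain a where a: "h \<le> a" "a < i" "maxrow n D i j = a" "(a, k) \<notin> D"
    and between: "{a<..<i} \<times> {j..k} \<subseteq> D"
    and alt: "a = h \<or> (\<exists>q. spans n D a j h q \<and> q \<le> k)"
    using spans_maxrow[OF less.prems assms(2)] by metis
  show ?case
  proof (cases "a = h")
    case True
    note bumps = path_bumps_last[OF less.prems a(3,4)[unfolded True] between[unfolded True]]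
    note m = move_row[OF less.prems a(4)[unfolded True] between[unfolded True]]
    have rows: "(\<exists>c. (r, c) \<in> path n D i j - D) \<longleftrightarrow> r = i \<or> r = h" for r
      unfolding bumps using s by auto
    have cols: "(\<exists>r. (r, c) \<in> path n D i j - D) \<longleftrightarrow>
        c = k \<or> j \<le> c \<and> c \<le> k \<and> (h, c) \<notin> D" for c
      unfolding bumps by auto
    have "(r, c) \<in> move n i j D \<longleftrightarrow> (r, c) \<in> path_procedure n i j D" for r c
    proof -
      have move: "(r, c) \<in> move n i j D \<longleftrightarrow>
          (r, c) \<in> D \<and> \<not> (r = i \<and> j \<le> c \<and> c < k \<and> (h, c) \<notin> D) \<or> r = h \<and> j < c \<and> c \<le> k"
        unfolding conjunct2[OF m] by auto
      consider "c < j" | "c = j" | "j < c" "c < k" | "c = k" | "k < c" by linarith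
      then show ?thesis
        unfolding mem rows cols move unfolding bumps using s by cases auto
    qed
    then have "move n i j D = path_procedure n i j D" by (intro set_eqI) (simp only: split_paired_all)
    with m show ?thesis by blast
  next
    case False
    then obtain q where q: "spans n D a j h q" "q \<le> k" using alt by auto
    note sq = q(1)[unfolded spans_def]
    have "j < q" "j < k" using sq s by auto
    define B where "B = path n D a j - D"
    define D' where "D' = path_procedure n a j D"
    have IH: "move_dom (n, a, j, D)" "move n a j D = D'"
      using less.IH[OF a(2) q(1)] by (auto simp: D'_def)
    have mem': "(r, c) \<in> D' \<longleftrightarrow>
        (r, c) \<in> D \<and> \<not> (c = j \<and> (\<exists>c'. (r, c') \<in> B)) \<and> \<not> (r = a \<and> (\<exists>r'. (r', c) \<in> B)) \<or>
        (r, c) \<in> B \<and> (r, c) \<noteq> (h, j) \<and> (r, c) \<noteq> (a, q)" for r c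
      unfolding D'_def B_def by (rule mem_path_procedure[OF q(1) assms(2)])
    note bumps = path_bumps_step[OF less.prems a(3) q a(2,4) between, folded B_def]
    note p = path_endpoints[OF q(1) assms(2)]
    have B: "(h, j) \<in> B" "(a, q) \<in> B" using p(1,2) sq by (auto simp: B_def)
    have Bsub: "h \<le> r \<and> r \<le> a \<and> j \<le> c \<and> c \<le> q \<and> (r, c) \<notin> D" if "(r, c) \<in> B" for r c
      using p(3)[of r c] that by (auto simp: B_def)
    have Bj: "r = h" if "(r, j) \<in> B" for r using p(4) that by (auto simp: B_def)
    have Ba: "c = q" if "(a, c) \<in> B" for c using p(5) that by (auto simp: B_def)
    have lower: "(r, c) \<in> D' \<longleftrightarrow> (r, c) \<in> D" if "a < r" for r c
    proof -
      have "(r, c') \<notin> B" for c' using Bsub[of r c'] that by linarith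
      then show ?thesis using that by (simp add: mem')
    qed
    \<comment> \<open>Row \<open>a\<close> of \<open>D'\<close> has its old bumps and one in every
      column meeting \<open>B\<close>. Column \<open>j\<close> is among these through
      \<open>(h, j)\<close>, which makes \<open>(a, j)\<close> the new top left corner.\<close>
    have row_a: "(a, c) \<in> D' \<longleftrightarrow> (a, c) \<in> D \<and> \<not> (\<exists>r. (r, c) \<in> B)" for c
      unfolding mem' using B(1) Ba by blast
    have col: "(r, c) \<notin> B" if "c < j \<or> q < c" for r c
      using Bsub[of r c] that by linarith
    have aj: "(a, j) \<notin> D'" and ak: "(a, k) \<notin> D'"
      unfolding row_a using B a(4) q(2) by (blast, blast)
    have sp: "spans n D' i j a k"
      using s a sq lower aj unfolding spans_def by auto
    have "{a<..<i} \<times> {j..k} \<subseteq> D'" using between lower by auto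
    note m = move_row[OF sp ak this]
    have dom: "move_dom (n, i, j, D)"
      by (rule move.domintros) (use a False IH m spansD[OF less.prems] in auto)
    have eq: "move n i j D = move n i j D'"
      using a False IH spansD[OF less.prems] by (simp add: move.psimps[OF dom])
    have rows: "(\<exists>c. (r, c) \<in> path n D i j - D) \<longleftrightarrow> r = i \<or> (\<exists>c. (r, c) \<in> B)" for r
      unfolding bumps using B by auto
    have cols: "(\<exists>r. (r, c) \<in> path n D i j - D) \<longleftrightarrow>
        c = k \<or> q \<le> c \<and> c \<le> k \<and> (a, c) \<notin> D \<or> (\<exists>r. (r, c) \<in> B)" for c
      unfolding bumps by auto
    have "(r, c) \<in> move n i j D \<longleftrightarrow> (r, c) \<in> path_procedure n i j D" for r c
    proof -
      have move: "(r, c) \<in> move n i j D \<longleftrightarrow>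
          (r, c) \<in> D' \<and> \<not> (r = i \<and> j \<le> c \<and> c < k \<and> (a, c) \<notin> D') \<or> r = a \<and> j < c \<and> c \<le> k"
        unfolding eq conjunct2[OF m] by auto
      \<comment> \<open>The outer move changes rows \<open>i\<close> and \<open>a\<close> only. Row
        \<open>i\<close> receives the bumps of row \<open>a\<close> of \<open>D'\<close> in columns
        \<open>j\<close> to \<open>k - 1\<close>. Row \<open>a\<close> becomes crosses in columns
        \<open>j + 1\<close> to \<open>k\<close>: from \<open>q\<close> on this is step (iii), and
        left of \<open>q\<close> it restores crosses of \<open>D\<close>.\<close>
      consider "r = i" | "r = a" | "r \<noteq> i" "r \<noteq> a" by linarith
      then show ?thesis
      proof cases
        case 1
        define X where "X \<longleftrightarrow> (\<exists>r. (r, c) \<in> B)"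
        have X: "c = j \<Longrightarrow> X" "c < j \<or> q < c \<Longrightarrow> \<not> X"
          using B(1) col[of c] by (auto simp: X_def)
        have "(i, c) \<notin> B" using Bsub[of i c] a(2) by linarith
        then have proc: "(r, c) \<in> path_procedure n i j D \<longleftrightarrow>
            (i, c) \<in> D \<and> c \<noteq> j \<and> \<not> (c = k \<or> q \<le> c \<and> c \<le> k \<and> (a, c) \<notin> D \<or> X)"
          unfolding mem rows cols X_def[symmetric] unfolding bumps using 1 a(2) by auto
        have mv: "(r, c) \<in> move n i j D \<longleftrightarrow>
            (i, c) \<in> D \<and> \<not> (j \<le> c \<and> c < k \<and> ((a, c) \<notin> D \<or> X))"
          unfolding move row_a X_def[symmetric] using 1 a(2) lower[OF a(2)] by simp
        have row: "j \<le> c \<Longrightarrow> c < q \<Longrightarrow> (a, c) \<in> D" and ik: "(i, k) \<notin> D" using sq s by auto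
        consider "c < j" | "c = j" | "j < c" "c < q" | "q \<le> c" "c < k" | "c = k" | "k < c"
          by linarith
        then show ?thesis unfolding proc mv using row ik X \<open>j < q\<close> q(2) \<open>j < k\<close> by cases simp_all
      next
        case 2
        have proc: "(r, c) \<in> path_procedure n i j D \<longleftrightarrow>
            (a, c) \<in> D \<and> c \<noteq> j \<or> q \<le> c \<and> c \<le> k \<and> (a, c) \<notin> D \<or> (a, c) \<in> B"
          unfolding mem rows cols unfolding bumps using 2 a(2) B(2) False by auto
        have mv: "(r, c) \<in> move n i j D \<longleftrightarrow>
            (a, c) \<in> D \<and> \<not> (\<exists>r. (r, c) \<in> B) \<or> j < c \<and> c \<le> k"
          unfolding move using 2 a(2) row_a[of c] by auto
        have row: "j \<le> c \<Longrightarrow> c < q \<Longrightarrow> (a, c) \<in> D" using sq by auto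
        have no_col: "c < j \<or> q < c \<Longrightarrow> \<not> (\<exists>r. (r, c) \<in> B)" using col[of c] by blast
        have col_j: "c = j \<Longrightarrow> \<exists>r. (r, c) \<in> B" using B(1) by blast
        have B_a: "(a, c) \<in> B \<Longrightarrow> c = q" by (rule Ba)
        consider "c < j" | "c = j" | "j < c" "c < q" | "q \<le> c" "c \<le> k" | "k < c"
          by linarith
        then show ?thesis
          unfolding proc mv using row no_col col_j B_a \<open>j < q\<close> q(2) by cases auto
      next
        \<comment> \<open>In the other rows the path bumps are exactly those of \<open>B\<close>, so
          the procedures for \<open>(a, j)\<close> and \<open>(i, j)\<close> agree.\<close>
        case 3
        then show ?thesis
          unfolding move mem rows cols mem' unfolding bumps by blast
      qed
    qed
    then have "move n i j D = path_procedure n i j D" by (intro set_eqI) (simp only: split_paired_all)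
    with dom show ?thesis by blast
  qed
qed

theorem proposition3p10:
  fixes n i j :: nat and w :: "nat \<Rightarrow> nat" and D :: tiling
  assumes "w permutes {1..n}"
    and "D \<in> RPD w"
    and "movable D i j"
  shows "move n i j D = path_procedure n i j D"
proof -
  obtain h k where "spans n D i j h k" using obtain_spans[OF assms] .
  with RPD_no_double_crossing_rect[OF assms(2)] show ?thesis
    using move_eq_path_procedure by blast
qed

end
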